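(* Let $C=\bigcup_n C_n$ be a finite union of cells of the MAC grid indexed by their centers $n\in\mathbb Z^2$, and let $q^u_{n+e_1/2},q^v_{n+e_2/2}\in\mathbb R$ be source values attached to these cells. Then the velocity and pressure potentials $$\bm u(m)=\begin{bmatrix}u(m+e_1/2)\\ v(m+e_2/2)\end{bmatrix}=\sum_n\mathcal S(m,n)\begin{bmatrix}q^u_{n+e_1/2}\\ q^v_{n+e_2/2}\end{bmatrix},\qquad p(m)=\sum_n\mathcal P(m,n)\begin{bmatrix}q^u_{n+e_1/2}\\ q^v_{n+e_2/2}\end{bmatrix}\qquad(m\in\mathbb Z^2)$$ satisfy the homogeneous Stokes difference equations at every lattice point whose stencil does not intersect $C$.
   Context: Notation. $h>0$ is the grid spacing, $\mu>0$ the viscosity, $m=(m_1,m_2)$, $n=(n_1,n_2)$, $e_1=(1,0)$, $e_2=(0,1)$. Positions are given in units of $h$. $C_n$ is the closed unit square cell centered at $n$, so that $n+e_1/2$ and $n+e_2/2$ are the midpoints of two of its faces. Horizontal velocities $u$ live at nodes $m+e_1/2$, vertical velocities $v$ at nodes $m+e_2/2$, pressures $p$ at cell centers $m$. Homogeneous Stokes difference equations (MAC scheme): $$-\mu Lu_{m_1+1/2,m_2}+h(p_{m_1+1,m_2}-p_{m_1,m_2})=0,\qquad -\mu Lv_{m_1,m_2+1/2}+h(p_{m_1,m_2+1}-p_{m_1,m_2})=0,$$ $$u_{m_1+1/2,m_2}-u_{m_1-1/2,m_2}+v_{m_1,m_2+1/2}-v_{m_1,m_2-1/2}=0,$$ where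 $L$ is the unscaled five-point operator, $(L\phi)(m)=\phi(m+e_1)+\phi(m-e_1)+\phi(m+e_2)+\phi(m-e_2)-4\phi(m)$, applied on the respective velocity grid. The stencil of one of these equations is the set of grid nodes it involves, together with the lattice point at which it is posed. Kernels. $\mathcal S(m,n)=\mathcal S(m-n)$ and $\mathcal P(m,n)=\mathcal P(m-n)$, where, with $D_x^\pm,D_y^\pm,D_{xx},D_{yy}$ the unscaled forward/backward/second differences in the first and second index, $$\mathcal S(m_1,m_2)=-\frac1\mu\begin{bmatrix} D_{yy}H(m_1,m_2) & -D_y^+D_x^+H(m_1,m_2-1)\\ -D_y^+D_x^+H(m_1-1,m_2) & D_{xx}H(m_1,m_2)\end{bmatrix},\qquad \mathcal P(m_1,m_2)=\frac1h\begin{bmatrix} D_x^-G(m_1,m_2)\\ D_y^-G(m_1,m_2)\end{bmatrix},$$ with $\mathcal P$ acting on a source vector $(a,b)^T$ by $\mathcal P_1a+\mathcal P_2b$. Here $G$ is the regularized Laplace lattice Green's function $G(m)=\frac1{4\pi^2}\int_{[-\pi,\pi]^2}\frac{e^{im\cdot\theta}-1}{2\cos\theta_1+2\cos\theta_2-4}\,d\theta$ and $H$ is the regularized biharmonic lattice Green's function given by $$16H(m_1,m_2)=m_1^2\bigl(2G(m_1,m_2)+G(m_1,m_2+1)+G(m_1,m_2-1)\bigr)+m_2^2\bigl(2G(m_1,m_2)+G(m_1+1,m_2)+G(m_1-1,m_2)\bigr)-2G(m_1,m_2).$$ *)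

theory Defs
  imports "HOL-Analysis.Analysis"
begin

type_synonym lattice = "int \<times> int"

abbreviation e1 :: lattice where "e1 \<equiv> (1, 0)"
abbreviation e2 :: lattice where "e2 \<equiv> (0, 1)"

text \<open>
  All grid functions are indexed by \<open>m :: lattice\<close>: for horizontal velocities \<open>u m\<close> is the value
  at the position \<open>m + e1/2\<close>, for vertical velocities \<open>v m\<close> is the value at \<open>m + e2/2\<close>, and for
  pressures \<open>p m\<close> is the value at the cell centre \<open>m\<close>. Positions are in units of the grid spacing.
\<close>

definition u_node :: "lattice \<Rightarrow> real \<times> real" where
  "u_node m = (of_int (fst m) + 1/2, of_int (snd m))"

definition v_node :: "lattice \<Rightarrow> real \<times> real" where
  "v_node m = (of_int (fst m), of_int (snd m) + 1/2)"

definition p_node :: "lattice \<Rightarrow> real \<times> real" where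
  "p_node m = (of_int (fst m), of_int (snd m))"

definition cell :: "lattice \<Rightarrow> (real \<times> real) set" where
  "cell n = cbox (p_node n - (1/2, 1/2)) (p_node n + (1/2, 1/2))"

definition Dxp :: "(lattice \<Rightarrow> real) \<Rightarrow> lattice \<Rightarrow> real" where
  "Dxp f m = f (m + e1) - f m"

definition Dyp :: "(lattice \<Rightarrow> real) \<Rightarrow> lattice \<Rightarrow> real" where
  "Dyp f m = f (m + e2) - f m"

definition Dxm :: "(lattice \<Rightarrow> real) \<Rightarrow> lattice \<Rightarrow> real" where
  "Dxm f m = f m - f (m - e1)"

definition Dym :: "(lattice \<Rightarrow> real) \<Rightarrow> lattice \<Rightarrow> real" where
  "Dym f m = f m - f (m - e2)"

definition Dxx :: "(lattice \<Rightarrow> real) \<Rightarrow> lattice \<Rightarrow> real" where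
  "Dxx f m = f (m + e1) - 2 * f m + f (m - e1)"

definition Dyy :: "(lattice \<Rightarrow> real) \<Rightarrow> lattice \<Rightarrow> real" where
  "Dyy f m = f (m + e2) - 2 * f m + f (m - e2)"

definition L :: "(lattice \<Rightarrow> real) \<Rightarrow> lattice \<Rightarrow> real" where
  "L f m = f (m + e1) + f (m - e1) + f (m + e2) + f (m - e2) - 4 * f m"

definition momentum_u :: "real \<Rightarrow> real \<Rightarrow> (lattice \<Rightarrow> real) \<Rightarrow> (lattice \<Rightarrow> real) \<Rightarrow> lattice \<Rightarrow> bool" where
  "momentum_u h \<mu> u p m \<longleftrightarrow> - \<mu> * L u m + h * (p (m + e1) - p m) = 0"

definition momentum_v :: "real \<Rightarrow> real \<Rightarrow> (lattice \<Rightarrow> real) \<Rightarrow> (lattice \<Rightarrow> real) \<Rightarrow> lattice \<Rightarrow> bool" where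
  "momentum_v h \<mu> v p m \<longleftrightarrow> - \<mu> * L v m + h * (p (m + e2) - p m) = 0"

definition continuity :: "(lattice \<Rightarrow> real) \<Rightarrow> (lattice \<Rightarrow> real) \<Rightarrow> lattice \<Rightarrow> bool" where
  "continuity u v m \<longleftrightarrow> u m - u (m - e1) + v m - v (m - e2) = 0"

definition stencil_u :: "lattice \<Rightarrow> (real \<times> real) set" where
  "stencil_u m = u_node ` {m, m + e1, m - e1, m + e2, m - e2} \<union> p_node ` {m, m + e1}"

definition stencil_v :: "lattice \<Rightarrow> (real \<times> real) set" where
  "stencil_v m = v_node ` {m, m + e1, m - e1, m + e2, m - e2} \<union> p_node ` {m, m + e2}"

text \<open>The continuity equation is posed at the cell centre, which carries none of its unknowns.\<close>

definition stencil_c :: "lattice \<Rightarrow> (real \<times> real) set" where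
  "stencil_c m = u_node ` {m, m - e1} \<union> v_node ` {m, m - e2} \<union> {p_node m}"

definition G_integral :: "lattice \<Rightarrow> complex" where
  "G_integral m = complex_of_real (1 / (4 * pi\<^sup>2)) *
     (LINT \<theta> : {-pi..pi} \<times> {-pi..pi} | lborel.
        (exp (\<i> * complex_of_real (of_int (fst m) * fst \<theta> + of_int (snd m) * snd \<theta>)) - 1) /
        complex_of_real (2 * cos (fst \<theta>) + 2 * cos (snd \<theta>) - 4))"

text \<open>Taking the real part loses nothing, see \<open>of_real_G\<close> below.\<close>

definition G :: "lattice \<Rightarrow> real" where
  "G m = Re (G_integral m)"

lemma of_real_G: "complex_of_real (G m) = G_integral m"
proof -
  define f :: "real \<times> real \<Rightarrow> complex" where
    "f \<theta> = indicator ({-pi..pi} \<times> {-pi..pi}) \<theta> *\<^sub>R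
       ((exp (\<i> * complex_of_real (of_int (fst m) * fst \<theta> + of_int (snd m) * snd \<theta>)) - 1) /
        complex_of_real (2 * cos (fst \<theta>) + 2 * cos (snd \<theta>) - 4))" for \<theta>
  have *: "cnj (f \<theta>) = f (- \<theta>)" for \<theta>
    by (cases \<theta>) (auto simp: f_def exp_cnj algebra_simps indicator_def)
  have [measurable]: "f \<in> borel_measurable borel"
    unfolding f_def
    by (intro borel_measurable_scaleR borel_measurable_indicator borel_measurable_divide
        borel_closed closed_Times closed_atLeastAtMost borel_measurable_continuous_onI
        continuous_intros)
  have uminus: "distr lborel borel uminus = (lborel :: (real \<times> real) measure)"
    using lborel_affine[of "-1" "0 :: real \<times> real"] by (simp add: density_1)
  have "cnj (integral\<^sup>L lborel f) = (LINT \<theta>|lborel. f (- \<theta>))"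
    unfolding * [symmetric]
    by (rule integral_bounded_linear'[OF bounded_linear_cnj bounded_linear_cnj, symmetric]) simp
  also have "\<dots> = integral\<^sup>L (distr lborel borel uminus) f"
    by (subst integral_distr) auto
  also have "\<dots> = integral\<^sup>L lborel f"
    by (simp only: uminus)
  finally have "Im (integral\<^sup>L lborel f) = 0"
    using Reals_cnj_iff complex_is_Real_iff by blast
  moreover have "G_integral m = complex_of_real (1 / (4 * pi\<^sup>2)) * integral\<^sup>L lborel f"
    unfolding G_integral_def set_lebesgue_integral_def f_def ..
  ultimately show ?thesis
    by (simp only: G_def complex_eq_iff) simp
qed

definition H :: "lattice \<Rightarrow> real" where
  "H m = (of_int (fst m) ^ 2 * (2 * G m + G (m + e2) + G (m - e2))
        + of_int (snd m) ^ 2 * (2 * G m + G (m + e1) + G (m - e1))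
        - 2 * G m) / 16"

definition kernel_S :: "real \<Rightarrow> lattice \<Rightarrow> real^2^2" where
  "kernel_S \<mu> m = (- 1 / \<mu>) *\<^sub>R vector
     [vector [Dyy H m, - Dyp (Dxp H) (m - e2)],
      vector [- Dyp (Dxp H) (m - e1), Dxx H m]]"

definition kernel_P :: "real \<Rightarrow> lattice \<Rightarrow> real^2" where
  "kernel_P h m = (1 / h) *\<^sub>R vector [Dxm G m, Dym G m]"

end

(* Away from the sources, everything reduces to L H = G + const and L G = 0, since the kernels are
   difference quotients of H and G.  The Fourier integrand of G is O(1/|theta|), hence integrable, and
   its real part (cos(m.theta) - 1)/sigma is bounded, sigma being the symbol of L.  Then L G is the
   integral of cos(m.theta), which vanishes for m /= 0.  Inserting the formula for H into L H, the terms
   with quadratic coefficients drop out because L G is supported at the origin; the linear ones are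
   integrated by parts in theta_1 and theta_2, against cos(m.theta) - 1 rather than cos(m.theta) so that
   all integrands stay bounded at theta = 0.  What is left does not depend on m. *)

theory Submission
  imports Defs
begin

section \<open>The torus and the Fourier symbol of \<open>L\<close>\<close>

definition torus :: "(real \<times> real) measure" where
  "torus = restrict_space lborel ({-pi..pi} \<times> {-pi..pi})"

text \<open>The Fourier multiplier of \<open>L\<close>: on exp(i m.\<theta>), as a function of m,
  the operator \<open>L\<close> acts as multiplication by \<open>symb \<theta>\<close>.\<close>

definition symb :: "real \<times> real \<Rightarrow> real" where
  "symb \<theta> = 2 * cos (fst \<theta>) + 2 * cos (snd \<theta>) - 4"

definition phase :: "lattice \<Rightarrow> real \<times> real \<Rightarrow> real" where
  "phase m \<theta> = of_int (fst m) * fst \<theta> + of_int (snd m) * snd \<theta>"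

lemma abs_sin_of_nat_mult_le: "\<bar>sin (real k * x)\<bar> \<le> real k * \<bar>sin x\<bar>"
proof (induction k)
  case (Suc k)
  have "\<bar>sin (real (Suc k) * x)\<bar> = \<bar>sin (real k * x) * cos x + cos (real k * x) * sin x\<bar>"
    by (simp add: sin_add algebra_simps)
  also have "\<dots> \<le> \<bar>sin (real k * x)\<bar> * \<bar>cos x\<bar> + \<bar>cos (real k * x)\<bar> * \<bar>sin x\<bar>"
    by (metis abs_mult abs_triangle_ineq)
  also have "\<dots> \<le> \<bar>sin (real k * x)\<bar> * 1 + 1 * \<bar>sin x\<bar>"
    by (intro add_mono mult_left_mono mult_right_mono) auto
  finally show ?case using Suc by (simp add: distrib_right)
qed simp

lemma abs_sin_of_int_mult_le: "\<bar>sin (real_of_int k * x)\<bar> \<le> \<bar>real_of_int k\<bar> * \<bar>sin x\<bar>"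
proof (cases "k \<ge> 0")
  case True
  then show ?thesis using abs_sin_of_nat_mult_le[of "nat k" x] by simp
next
  case False
  then show ?thesis using abs_sin_of_nat_mult_le[of "nat (-k)" x] by simp
qed

lemma one_minus_cos: "1 - cos x = 2 * (sin (x / 2))\<^sup>2" for x :: real
  using cos_double_sin[of "x / 2"] by simp

lemma symb_eq: "symb \<theta> = - 4 * ((sin (fst \<theta> / 2))\<^sup>2 + (sin (snd \<theta> / 2))\<^sup>2)"
  using one_minus_cos[of "fst \<theta>"] one_minus_cos[of "snd \<theta>"] by (simp add: symb_def)

lemma symb_nonpos: "symb \<theta> \<le> 0"
  by (simp add: symb_eq)

text \<open>Comparing half-angle sines through |sin(k x)| <= |k| |sin x| gives a bound valid for
  every \<theta>, not only near 0. It is what keeps the real part of the integrand of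
  \<open>G\<close> bounded.\<close>

lemma one_minus_cos_phase_le:
  "1 - cos (phase m \<theta>) \<le> ((of_int (fst m))\<^sup>2 + (of_int (snd m))\<^sup>2) * - symb \<theta>"
proof -
  define s t where "s = sin (fst \<theta> / 2)" and "t = sin (snd \<theta> / 2)"
  define a b where "a = real_of_int (fst m)" and "b = real_of_int (snd m)"
  have "\<bar>sin (phase m \<theta> / 2)\<bar> = \<bar>sin (a * (fst \<theta> / 2)) * cos (b * (snd \<theta> / 2))
          + cos (a * (fst \<theta> / 2)) * sin (b * (snd \<theta> / 2))\<bar>"
    by (simp add: phase_def a_def b_def sin_add [symmetric] add_divide_distrib)
  also have "\<dots> \<le> \<bar>sin (a * (fst \<theta> / 2))\<bar> * \<bar>cos (b * (snd \<theta> / 2))\<bar>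
          + \<bar>cos (a * (fst \<theta> / 2))\<bar> * \<bar>sin (b * (snd \<theta> / 2))\<bar>"
    by (metis abs_mult abs_triangle_ineq)
  also have "\<dots> \<le> \<bar>sin (a * (fst \<theta> / 2))\<bar> * 1 + 1 * \<bar>sin (b * (snd \<theta> / 2))\<bar>"
    by (intro add_mono mult_left_mono mult_right_mono) auto
  also have "\<dots> \<le> \<bar>a\<bar> * \<bar>s\<bar> + \<bar>b\<bar> * \<bar>t\<bar>"
    using abs_sin_of_int_mult_le[of "fst m" "fst \<theta> / 2"] abs_sin_of_int_mult_le[of "snd m" "snd \<theta> / 2"]
    by (simp add: a_def b_def s_def t_def)
  finally have "(sin (phase m \<theta> / 2))\<^sup>2 \<le> (\<bar>a\<bar> * \<bar>s\<bar> + \<bar>b\<bar> * \<bar>t\<bar>)\<^sup>2"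
    by (metis abs_ge_zero power2_abs power_mono)
  also have "\<dots> \<le> 2 * (a\<^sup>2 * s\<^sup>2 + b\<^sup>2 * t\<^sup>2)"
    using sum_squares_bound[of "\<bar>a\<bar> * \<bar>s\<bar>" "\<bar>b\<bar> * \<bar>t\<bar>"] by (simp add: power2_sum power_mult_distrib)
  also have "\<dots> \<le> 2 * ((a\<^sup>2 + b\<^sup>2) * (s\<^sup>2 + t\<^sup>2))"
    by (simp add: algebra_simps)
  finally have "2 * (sin (phase m \<theta> / 2))\<^sup>2 \<le> (a\<^sup>2 + b\<^sup>2) * (4 * (s\<^sup>2 + t\<^sup>2))"
    by (simp add: algebra_simps)
  then show ?thesis
    by (simp add: one_minus_cos symb_eq add.commute a_def b_def s_def t_def)
qed

lemma sin_squared_le: "(sin x)\<^sup>2 \<le> 2 * (1 - cos x)" for x :: real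
proof -
  have "(sin x)\<^sup>2 = (1 + cos x) * (1 - cos x)"
    using sin_squared_eq[of x] by (simp add: algebra_simps power2_eq_square)
  also have "\<dots> \<le> 2 * (1 - cos x)"
    by (intro mult_right_mono) auto
  finally show ?thesis .
qed

text \<open>On the square the half angles lie in [-pi/2, pi/2], where the sine vanishes only at
  0.\<close>

lemma symb_zero_iff:
  assumes "\<theta> \<in> {-pi..pi} \<times> {-pi..pi}"
  shows "symb \<theta> = 0 \<longleftrightarrow> \<theta> = 0"
proof -
  have *: "x = 0" if "sin (x / 2) = 0" "x \<in> {-pi..pi}" for x :: real
  proof (rule ccontr)
    assume "x \<noteq> 0"
    then consider "x / 2 > 0" | "- (x / 2) > 0" by linarith
    then show False
    proof cases
      case 1
      then show False using sin_gt_zero[of "x / 2"] that by auto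
    next
      case 2
      then show False using sin_gt_zero[of "- (x / 2)"] that by auto
    qed
  qed
  have "symb \<theta> = 0 \<longleftrightarrow> sin (fst \<theta> / 2) = 0 \<and> sin (snd \<theta> / 2) = 0"
    unfolding symb_eq by (simp del: distrib_left_numeral mult_minus_left)
  also have "\<dots> \<longleftrightarrow> \<theta> = 0"
    using *[of "fst \<theta>"] *[of "snd \<theta>"] assms by (cases \<theta>) (auto simp: zero_prod_def)
  finally show ?thesis .
qed

lemma square_in_sets [simp]: "{-pi..pi} \<times> {-pi..pi} \<in> sets (borel :: (real \<times> real) measure)"
  by (intro borel_closed closed_Times) auto

lemma AE_torus: "AE \<theta> in torus. symb \<theta> \<noteq> 0"
proof -
  have "AE \<theta> in lborel. \<theta> \<noteq> (0 :: real \<times> real)"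
    by (rule AE_lborel_singleton)
  then show ?thesis
    unfolding torus_def by (subst AE_restrict_space_iff) (auto simp: symb_zero_iff elim!: eventually_mono)
qed

lemma finite_measure_torus: "finite_measure torus"
proof
  have "emeasure lborel ({-pi..pi} \<times> {-pi..pi} :: (real \<times> real) set) < \<infinity>"
    by (rule emeasure_bounded_finite) (simp add: bounded_Times)
  then show "emeasure torus (space torus) \<noteq> \<infinity>"
    by (simp add: torus_def space_restrict_space emeasure_restrict_space)
qed

lemma measurable_torus: "f \<in> borel_measurable borel \<Longrightarrow> f \<in> borel_measurable torus"
  unfolding torus_def by (intro measurable_restrict_space1) simp

lemma symb_measurable [measurable]: "symb \<in> borel_measurable borel"
  unfolding symb_def by (intro borel_measurable_continuous_onI continuous_intros)

lemma phase_measurable [measurable]: "phase m \<in> borel_measurable borel"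
  unfolding phase_def by (intro borel_measurable_continuous_onI continuous_intros)

text \<open>The torus has finite measure and the zero set of \<open>symb\<close> in it is null, so a
  bound off that set suffices.\<close>

lemma integrable_torusI:
  fixes f :: "real \<times> real \<Rightarrow> real"
  assumes "f \<in> borel_measurable borel" and "\<And>\<theta>. symb \<theta> \<noteq> 0 \<Longrightarrow> \<bar>f \<theta>\<bar> \<le> B"
  shows "integrable torus f"
proof (rule finite_measure.integrable_const_bound[OF finite_measure_torus])
  show "AE \<theta> in torus. norm (f \<theta>) \<le> B"
    using AE_torus assms(2) by (auto elim!: eventually_mono)
qed (use assms in \<open>simp add: measurable_torus\<close>)

section \<open>Integrability of the singular integrand and the real form of \<open>G\<close>\<close>

lemma abs_sin_half_ge:
  assumes "\<bar>x\<bar> \<le> pi"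
  shows "\<bar>x\<bar> / 6 \<le> \<bar>sin (x / 2)\<bar>"
proof -
  define z where "z = x / 2"
  have z: "\<bar>z\<bar> \<le> 2"
    using assms pi_half_less_two by (simp add: z_def)
  \<comment> \<open>The cubic Taylor remainder: because |z| <= 2 it is at most 2/3 |z|, which leaves
    |z|/3 for the sine.\<close>
  have "\<bar>sin z - z\<bar> \<le> \<bar>z\<bar> ^ 3 / 6"
    using Maclaurin_sin_bound[of z 3]
    by (simp add: numeral_3_eq_3 sin_coeff_def field_simps)
  also have "\<dots> = \<bar>z\<bar> * \<bar>z\<bar>\<^sup>2 / 6"
    by (simp add: power3_eq_cube power2_eq_square)
  also have "\<dots> \<le> \<bar>z\<bar> * 2\<^sup>2 / 6"
    using z by (intro divide_right_mono mult_left_mono power_mono) auto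
  also have "\<dots> = 2 / 3 * \<bar>z\<bar>"
    by simp
  finally have "\<bar>z\<bar> / 3 \<le> \<bar>sin z\<bar>"
    by linarith
  then show ?thesis
    by (simp add: z_def)
qed

lemma integrable_inverse_sqrt:
  "integrable lborel (\<lambda>x. indicator {-pi..pi} x * (1 / sqrt \<bar>x\<bar>))"
proof -
  have 1: "integrable lborel (\<lambda>x. indicator {0..pi} x * x powr (-1/2))"
  proof -
    have "(\<lambda>x::real. x powr (-1/2)) absolutely_integrable_on {0..pi}"
      by (intro nonnegative_absolutely_integrable_1 integrable_on_powr_from_0) auto
    then show ?thesis
      unfolding set_integrable_def by (subst (asm) integrable_completion) auto
  qed
  have 2: "integrable lborel (\<lambda>x. indicator {0..pi} (- x) * (- x) powr (-1/2))"
    using lborel_integrable_real_affine[OF 1, of "-1" 0] by simp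
  \<comment> \<open>At x = 0, where the two half-intervals overlap, both sides are 0, since
    \<open>0 powr a = 0\<close> and \<open>1 / 0 = 0\<close>.\<close>
  have "(\<lambda>x. indicator {-pi..pi} x * (1 / sqrt \<bar>x\<bar>)) =
    (\<lambda>x. indicator {0..pi} x * x powr (-1/2) + indicator {0..pi} (- x) * (- x) powr (-1/2))"
    by (auto simp: fun_eq_iff indicator_def powr_minus powr_half_sqrt divide_simps)
  with Bochner_Integration.integrable_add[OF 1 2] show ?thesis by simp
qed

text \<open>AM-GM for the two half-angle sines; the resulting constant 9/2 is rounded up to 5. The
  bound trades the singularity 1 / sqrt(- \<open>symb \<theta>\<close>) for a product of functions
  of one variable, whose integrability follows from Fubini without polar coordinates.\<close>

lemma symb_ge:
  assumes "\<theta> \<in> {-pi..pi} \<times> {-pi..pi}"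
  shows "\<bar>fst \<theta>\<bar> * \<bar>snd \<theta>\<bar> \<le> 5 * - symb \<theta>"
proof -
  define s t where "s = \<bar>sin (fst \<theta> / 2)\<bar>" and "t = \<bar>sin (snd \<theta> / 2)\<bar>"
  have "\<bar>fst \<theta>\<bar> / 6 * (\<bar>snd \<theta>\<bar> / 6) \<le> s * t"
    unfolding s_def t_def using assms by (intro mult_mono abs_sin_half_ge) auto
  then have "\<bar>fst \<theta>\<bar> * \<bar>snd \<theta>\<bar> \<le> 36 * (s * t)"
    by simp
  also have "\<dots> \<le> 18 * (s\<^sup>2 + t\<^sup>2)"
    using sum_squares_bound[of s t] by simp
  also have "\<dots> \<le> 20 * (s\<^sup>2 + t\<^sup>2)"
    by simp
  also have "\<dots> = 5 * - symb \<theta>"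
    by (simp add: symb_eq s_def t_def)
  finally show ?thesis .
qed

lemma integrable_torus_inverse_sqrt:
  "integrable torus (\<lambda>\<theta>. 1 / sqrt \<bar>fst \<theta>\<bar> * (1 / sqrt \<bar>snd \<theta>\<bar>))"
proof -
  define f :: "real \<Rightarrow> real" where "f x = indicator {-pi..pi} x * (1 / sqrt \<bar>x\<bar>)" for x
  have f: "integrable lborel f"
    using integrable_inverse_sqrt by (simp add: f_def [abs_def])
  then have [measurable]: "f \<in> borel_measurable borel"
    by simp
  have "integrable (lborel \<Otimes>\<^sub>M lborel) (\<lambda>\<theta>. f (fst \<theta>) * f (snd \<theta>))"
  proof (rule lborel_pair.Fubini_integrable)
    have "integrable lborel (\<lambda>x. \<bar>f x\<bar> * (LBINT y. \<bar>f y\<bar>))"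
      using f by (intro integrable_mult_left integrable_abs)
    then show "integrable lborel (\<lambda>x. LBINT y. norm (f (fst (x, y)) * f (snd (x, y))))"
      by (simp add: abs_mult)
    show "AE x in lborel. integrable lborel (\<lambda>y. f (fst (x, y)) * f (snd (x, y)))"
      using f by simp
  qed measurable
  then show ?thesis
    unfolding torus_def by (subst integrable_restrict_space)
      (simp_all add: lborel_prod indicator_times mult_ac f_def)
qed

text \<open>The real part of the integrand of \<open>G\<close>. Where \<open>symb\<close> vanishes
  it is 0 by the convention for division, so the bound in \<open>abs_ratio_le\<close> holds
  everywhere.\<close>

definition ratio :: "lattice \<Rightarrow> real \<times> real \<Rightarrow> real" where
  "ratio m \<theta> = (cos (phase m \<theta>) - 1) / symb \<theta>"

lemma ratio_measurable [measurable]: "ratio m \<in> borel_measurable borel"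
  unfolding ratio_def by measurable

lemma abs_ratio_le: "\<bar>ratio m \<theta>\<bar> \<le> (of_int (fst m))\<^sup>2 + (of_int (snd m))\<^sup>2"
proof (cases "symb \<theta> = 0")
  case False
  then have "- symb \<theta> > 0" using symb_nonpos[of \<theta>] by linarith
  moreover have "\<bar>ratio m \<theta>\<bar> = (1 - cos (phase m \<theta>)) / (- symb \<theta>)"
    using symb_nonpos[of \<theta>] by (simp add: ratio_def abs_divide)
  ultimately show ?thesis
    using one_minus_cos_phase_le[of m \<theta>] by (simp only: divide_le_eq if_True)
qed (simp add: ratio_def)

lemma integrable_ratio: "integrable torus (ratio m)"
  by (rule integrable_torusI[OF ratio_measurable abs_ratio_le])

lemma AE_lborel_axes: "AE \<theta> in lborel. fst \<theta> \<noteq> (0 :: real) \<and> snd \<theta> \<noteq> (0 :: real)"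
proof -
  have "AE \<theta> in lborel \<Otimes>\<^sub>M lborel. fst \<theta> \<noteq> (0 :: real) \<and> snd \<theta> \<noteq> (0 :: real)"
  proof (rule lborel_pair.AE_pair_measure)
    show "AE x in lborel. AE y in lborel. fst (x, y) \<noteq> (0 :: real) \<and> snd (x, y) \<noteq> (0 :: real)"
      using AE_lborel_singleton[of 0] by (auto elim!: eventually_mono)
  qed measurable
  then show ?thesis
    by (simp only: lborel_prod)
qed

text \<open>On the axes the majorant of \<open>integrable_torus_inverse_sqrt\<close> is 0 by the
  convention for division and dominates nothing, so the axes are discarded as a null set.\<close>

lemma AE_torus_axes:
  "AE \<theta> in torus. \<theta> \<in> {-pi..pi} \<times> {-pi..pi} \<and> fst \<theta> \<noteq> 0 \<and> snd \<theta> \<noteq> 0"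
proof -
  have "{-pi..pi} \<times> {-pi..pi} \<inter> space lborel \<in> sets (lborel :: (real \<times> real) measure)"
    by simp
  note eq = AE_restrict_space_iff[OF this]
  show ?thesis
    unfolding torus_def eq using AE_lborel_axes by eventually_elim simp
qed

text \<open>Moving \<open>Re\<close> inside the integral in \<open>G_eq\<close> needs integrability
  of the complex integrand, whose imaginary part may grow like 1/|\<theta>|. From |exp(i t) - 1|^2 =
  2 (1 - cos t) the numerator is O(sqrt d) with d = - \<open>symb \<theta>\<close>, so the quotient
  is O(1 / sqrt d), and \<open>symb_ge\<close> yields the product majorant.\<close>

lemma integrable_G_integrand:
  "integrable torus (\<lambda>\<theta>. (exp (\<i> * complex_of_real (phase m \<theta>)) - 1) / complex_of_real (symb \<theta>))"
proof (rule Bochner_Integration.integrable_bound)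
  define K where "K = (real_of_int (fst m))\<^sup>2 + (of_int (snd m))\<^sup>2"
  show "integrable torus (\<lambda>\<theta>. sqrt (10 * K) * (1 / sqrt \<bar>fst \<theta>\<bar> * (1 / sqrt \<bar>snd \<theta>\<bar>)))"
    by (intro integrable_mult_right integrable_torus_inverse_sqrt)
  have *: "norm ((exp (\<i> * complex_of_real (phase m \<theta>)) - 1) / complex_of_real (symb \<theta>)) \<le>
      sqrt (10 * K) * (1 / sqrt \<bar>fst \<theta>\<bar> * (1 / sqrt \<bar>snd \<theta>\<bar>))"
    if \<theta>: "\<theta> \<in> {-pi..pi} \<times> {-pi..pi}" "fst \<theta> \<noteq> 0" "snd \<theta> \<noteq> 0" for \<theta>
  proof -
    define d r where "d = - symb \<theta>" and "r = \<bar>fst \<theta>\<bar> * \<bar>snd \<theta>\<bar>"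
    have r: "r > 0" "r \<le> 5 * d"
      using \<theta> symb_ge[of \<theta>] by (auto simp: d_def r_def)
    then have d: "d > 0" by linarith
    have "(norm (exp (\<i> * complex_of_real (phase m \<theta>)) - 1))\<^sup>2 = 2 * (1 - cos (phase m \<theta>))"
      by (simp add: dist_exp_i_1 one_minus_cos power_mult_distrib)
    also have "\<dots> \<le> 2 * (K * d)"
      using one_minus_cos_phase_le[of m \<theta>] by (simp add: K_def d_def)
    finally have "norm (exp (\<i> * complex_of_real (phase m \<theta>)) - 1) \<le> sqrt (2 * (K * d))"
      by (rule real_le_rsqrt)
    then have "norm (exp (\<i> * complex_of_real (phase m \<theta>)) - 1) / d \<le> sqrt (2 * (K * d)) / d"
      using d by (intro divide_right_mono) auto
    also have "\<dots> = sqrt (2 * K) * (sqrt d / d)"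
      by (simp add: real_sqrt_mult)
    also have "\<dots> = sqrt (2 * K) / sqrt d"
      using sqrt_divide_self_eq[of d] d by (simp add: divide_inverse)
    also have "\<dots> \<le> sqrt (2 * K) / sqrt (r / 5)"
      using r d by (intro divide_left_mono mult_pos_pos) (auto simp: K_def)
    also have "\<dots> = sqrt (10 * K) / sqrt r"
      using real_sqrt_mult[of 5 "2 * K"] by (simp add: real_sqrt_divide)
    finally have "norm (exp (\<i> * complex_of_real (phase m \<theta>)) - 1) / d \<le> sqrt (10 * K) / sqrt r" .
    moreover have "norm (complex_of_real (symb \<theta>)) = d"
      using d by (simp add: d_def)
    ultimately show ?thesis
      by (simp add: r_def real_sqrt_mult norm_divide)
  qed
  show "AE \<theta> in torus. norm ((exp (\<i> * complex_of_real (phase m \<theta>)) - 1) / complex_of_real (symb \<theta>))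
      \<le> norm (sqrt (10 * K) * (1 / sqrt \<bar>fst \<theta>\<bar> * (1 / sqrt \<bar>snd \<theta>\<bar>)))"
    using AE_torus_axes
  proof eventually_elim
    case (elim \<theta>)
    then show ?case
      using *[of \<theta>] by (simp only: real_norm_def) (blast intro: order_trans abs_ge_self)
  qed
  have "(\<lambda>\<theta>. (exp (\<i> * complex_of_real (phase m \<theta>)) - 1) / complex_of_real (symb \<theta>))
      \<in> borel_measurable borel"
    by measurable
  then show "(\<lambda>\<theta>. (exp (\<i> * complex_of_real (phase m \<theta>)) - 1) / complex_of_real (symb \<theta>))
      \<in> borel_measurable torus"
    by (rule measurable_torus)
qed

lemma G_eq: "G m = integral\<^sup>L torus (ratio m) / (4 * pi\<^sup>2)"
proof -
  have "Re (integral\<^sup>L torus (\<lambda>\<theta>. (exp (\<i> * complex_of_real (phase m \<theta>)) - 1) / complex_of_real (symb \<theta>)))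
    = integral\<^sup>L torus (ratio m)"
    by (subst integral_Re [symmetric, OF integrable_G_integrand])
       (simp add: ratio_def [abs_def] Re_exp)
  then show ?thesis
    unfolding G_def G_integral_def torus_def
    by (subst (asm) integral_restrict_space)
       (simp_all add: set_lebesgue_integral_def phase_def symb_def)
qed

section \<open>Vanishing integrals over the torus, and \<open>L G\<close> off the origin\<close>

lemma integral_torus: "integral\<^sup>L torus f = (\<integral>\<theta>. indicator ({-pi..pi} \<times> {-pi..pi}) \<theta> * f \<theta> \<partial>(lborel \<Otimes>\<^sub>M lborel))"
  for f :: "real \<times> real \<Rightarrow> real"
  unfolding torus_def by (subst integral_restrict_space) (simp_all add: lborel_prod)

text \<open>Since \<open>symb\<close> is symmetric in the two angles, this carries results obtained
  by integrating in theta_1 over to theta_2.\<close>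

lemma integral_torus_swap:
  fixes f :: "real \<times> real \<Rightarrow> real"
  assumes "f \<in> borel_measurable borel"
  shows "integral\<^sup>L torus (\<lambda>\<theta>. f (prod.swap \<theta>)) = integral\<^sup>L torus f"
proof -
  define g where "g \<theta> = indicator ({-pi..pi} \<times> {-pi..pi}) \<theta> * f \<theta>" for \<theta>
  have "f \<in> borel_measurable (lborel \<Otimes>\<^sub>M lborel)"
    using assms by (simp add: lborel_prod)
  then have "g \<in> borel_measurable (lborel \<Otimes>\<^sub>M lborel)"
    unfolding g_def by measurable
  have "integral\<^sup>L torus (\<lambda>\<theta>. f (prod.swap \<theta>)) = (\<integral>(x, y). g (y, x) \<partial>(lborel \<Otimes>\<^sub>M lborel))"
    by (simp add: integral_torus g_def indicator_times case_prod_unfold prod.swap_def mult_ac)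
  also have "\<dots> = integral\<^sup>L (lborel \<Otimes>\<^sub>M lborel) g"
    by (rule lborel_pair.integral_product_swap) fact
  also have "\<dots> = integral\<^sup>L torus f"
    by (simp add: integral_torus g_def [abs_def])
  finally show ?thesis .
qed

text \<open>Fubini with the theta_1-integral inside: each inner integral is F(pi, y) - F(-pi, y) = 0
  by the fundamental theorem of calculus. Leaving out the null line y = 0 avoids the singularity at
  the origin, so \<open>f\<close> need only be smooth along the other horizontal lines.\<close>

lemma integral_torus_eq_0:
  fixes f :: "real \<times> real \<Rightarrow> real"
  assumes "integrable torus f"
    and deriv: "\<And>x y. y \<in> {-pi..pi} \<Longrightarrow> y \<noteq> 0 \<Longrightarrow> ((\<lambda>x. F x y) has_real_derivative f (x, y)) (at x)"
    and cont: "\<And>y. y \<in> {-pi..pi} \<Longrightarrow> y \<noteq> 0 \<Longrightarrow> continuous_on UNIV (\<lambda>x. f (x, y))"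
    and periodic: "\<And>y. F pi y = F (-pi) y"
  shows "integral\<^sup>L torus f = 0"
proof -
  define g where "g \<theta> = indicator ({-pi..pi} \<times> {-pi..pi}) \<theta> * f \<theta>" for \<theta>
  have "integrable (lborel \<Otimes>\<^sub>M lborel) g"
    using assms(1) unfolding torus_def by (subst (asm) integrable_restrict_space) (simp_all add: lborel_prod g_def [abs_def])
  then have "integral\<^sup>L torus f = (\<integral>y. \<integral>x. g (x, y) \<partial>lborel \<partial>lborel)"
    using lborel_pair.integral_snd[of "\<lambda>x y. g (x, y)"]
    by (simp add: integral_torus g_def [abs_def] split_def)
  also have "\<dots> = (\<integral>y. 0 \<partial>(lborel :: real measure))"
  proof (rule Bochner_Integration.integral_cong_AE)
    show "(\<lambda>y. \<integral>x. g (x, y) \<partial>lborel) \<in> borel_measurable lborel"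
      using lborel_pair.integrable_snd[of "\<lambda>x y. g (x, y)"] \<open>integrable _ g\<close> by simp
    have "(\<integral>x. g (x, y) \<partial>lborel) = 0" if "y \<noteq> 0" for y
    proof (cases "y \<in> {-pi..pi}")
      case True
      have "(\<integral>x. indicator {-pi..pi} x *\<^sub>R f (x, y) \<partial>lborel) = F pi y - F (-pi) y"
        using deriv[OF True that] continuous_on_subset[OF cont[OF True that] subset_UNIV]
        by (intro integral_FTC_atLeastAtMost)
          (auto intro: has_vector_derivative_at_within simp: has_real_derivative_iff_has_vector_derivative)
      with True show ?thesis
        by (simp add: g_def indicator_times periodic)
    qed (simp add: g_def indicator_times)
    then show "AE y in lborel. (\<integral>x. g (x, y) \<partial>lborel) = 0"
      using AE_lborel_singleton[of 0] by (auto elim!: eventually_mono)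
  qed simp
  finally show ?thesis by simp
qed

lemma symb_swap [simp]: "symb (prod.swap \<theta>) = symb \<theta>"
  by (simp add: symb_def)

lemma phase_swap: "phase (prod.swap m) (prod.swap \<theta>) = phase m \<theta>"
  by (simp add: phase_def)

lemma phase_add: "phase (m + k) \<theta> = phase m \<theta> + phase k \<theta>"
  and phase_diff: "phase (m - k) \<theta> = phase m \<theta> - phase k \<theta>"
  and phase_e1: "phase e1 \<theta> = fst \<theta>"
  and phase_e2: "phase e2 \<theta> = snd \<theta>"
  by (simp_all add: phase_def algebra_simps)

text \<open>If the first component of \<open>m\<close> is nonzero, dividing sin(m.\<theta>) by it
  gives an antiderivative in theta_1, and the phases at theta_1 = pi and -pi differ by a multiple of
  2 pi. Otherwise the second component is nonzero and the angles are exchanged.\<close>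

lemma integral_cos_phase:
  assumes "m \<noteq> 0"
  shows "integral\<^sup>L torus (\<lambda>\<theta>. cos (phase m \<theta>)) = 0"
proof -
  have *: "integral\<^sup>L torus (\<lambda>\<theta>. cos (phase m \<theta>)) = 0" if m: "fst m \<noteq> 0" for m
  proof (rule integral_torus_eq_0[where F = "\<lambda>x y. sin (phase m (x, y)) / of_int (fst m)"])
    show "integrable torus (\<lambda>\<theta>. cos (phase m \<theta>))"
      by (rule integrable_torusI[where B = 1]) auto
    show "((\<lambda>x. sin (phase m (x, y)) / of_int (fst m)) has_real_derivative cos (phase m (x, y))) (at x)"
      for x y unfolding phase_def using m by (auto intro!: derivative_eq_intros)
    show "continuous_on UNIV (\<lambda>x. cos (phase m (x, y)))" for y
      unfolding phase_def by (auto intro!: continuous_intros)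
    show "sin (phase m (pi, y)) / of_int (fst m) = sin (phase m (- pi, y)) / of_int (fst m)" for y
      by (simp add: phase_def sin_add sin_diff sin_zero_iff_int2)
  qed
  show ?thesis
  proof (cases "fst m = 0")
    case True
    with assms have "fst (prod.swap m) \<noteq> 0"
      by (cases m) (auto simp: zero_prod_def)
    from *[OF this] have "integral\<^sup>L torus (\<lambda>\<theta>. cos (phase (prod.swap m) (prod.swap \<theta>))) = 0"
      by (subst integral_torus_swap[where f = "\<lambda>\<theta>. cos (phase (prod.swap m) \<theta>)"]) auto
    then show ?thesis
      by (simp only: phase_swap)
  qed (rule *)
qed

lemma has_integral_ratio: "has_bochner_integral torus (ratio m) (4 * pi\<^sup>2 * G m)"
  using integrable_ratio by (simp add: has_bochner_integral_iff G_eq)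

text \<open>\<open>L\<close> kills the constant -1 and multiplies cos(m.\<theta>) by
  \<open>symb \<theta>\<close>, which cancels the denominator.\<close>

lemma L_ratio: "symb \<theta> \<noteq> 0 \<Longrightarrow> L (\<lambda>k. ratio k \<theta>) m = cos (phase m \<theta>)"
  by (simp add: L_def ratio_def phase_add phase_diff phase_e1 phase_e2 cos_add cos_diff field_simps)
     (simp add: symb_def algebra_simps)

lemma L_G_eq_0:
  assumes "m \<noteq> 0"
  shows "L G m = 0"
proof -
  have "has_bochner_integral torus (\<lambda>\<theta>. L (\<lambda>k. ratio k \<theta>) m) (L (\<lambda>k. 4 * pi\<^sup>2 * G k) m)"
    unfolding L_def by (intro has_bochner_integral_add has_bochner_integral_diff
        has_bochner_integral_mult_right has_integral_ratio)
  then have hbi: "has_bochner_integral torus (\<lambda>\<theta>. L (\<lambda>k. ratio k \<theta>) m) (4 * pi\<^sup>2 * L G m)"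
    by (simp add: L_def algebra_simps)
  moreover have "integral\<^sup>L torus (\<lambda>\<theta>. L (\<lambda>k. ratio k \<theta>) m) = integral\<^sup>L torus (\<lambda>\<theta>. cos (phase m \<theta>))"
  proof (rule Bochner_Integration.integral_cong_AE)
    show "(\<lambda>\<theta>. L (\<lambda>k. ratio k \<theta>) m) \<in> borel_measurable torus"
      using hbi by (auto simp: has_bochner_integral_iff)
    show "AE \<theta> in torus. L (\<lambda>k. ratio k \<theta>) m = cos (phase m \<theta>)"
      using AE_torus by eventually_elim (rule L_ratio)
  qed (intro measurable_torus, measurable)
  ultimately show ?thesis
    using integral_cos_phase[OF assms] by (simp add: has_bochner_integral_iff)
qed

section \<open>Integration by parts and the defect of the biharmonic equation\<close>

lemma borel_measurable_fst_snd:
  "fst \<in> borel_measurable (borel :: (real \<times> real) measure)"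
  "snd \<in> borel_measurable (borel :: (real \<times> real) measure)"
  by (intro borel_measurable_continuous_onI continuous_intros)+

text \<open>The derivative in \<open>\<theta>\<^sub>1\<close> of \<open>(cos (m \<bullet> \<theta>) - 1) \<cdot> 2 sin \<theta>\<^sub>1 (2 + 2 cos \<theta>\<^sub>2) / \<sigma>(\<theta>)\<close>.\<close>

definition flux :: "lattice \<Rightarrow> real \<times> real \<Rightarrow> real" where
  "flux m \<theta> = (2 + 2 * cos (snd \<theta>)) *
     (- 2 * of_int (fst m) * (sin (phase m \<theta>) * sin (fst \<theta>) / symb \<theta>)
      + ratio m \<theta> * ((2 * cos (fst \<theta>) * symb \<theta> + 4 * (sin (fst \<theta>))\<^sup>2) / symb \<theta>))"

lemma flux_measurable [measurable]: "flux m \<in> borel_measurable borel"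
  supply borel_measurable_fst_snd [measurable] unfolding flux_def by measurable

text \<open>With d = - \<open>symb \<theta>\<close>, both sin(m.\<theta>)^2 and sin(theta_1)^2 are
  O(d), so by AM-GM their product term over d is bounded. In the other term \<open>ratio\<close> is
  bounded, and its cofactor is at most 2 + 4 = 6 because sin(theta_1)^2 <= d.\<close>

lemma abs_flux_le:
  defines "K \<equiv> \<lambda>m. (real_of_int (fst m))\<^sup>2 + (real_of_int (snd m))\<^sup>2"
  assumes "symb \<theta> \<noteq> 0"
  shows "\<bar>flux m \<theta>\<bar> \<le> 4 * (2 * \<bar>of_int (fst m)\<bar> * (K m + 1) + K m * 6)"
proof -
  define d where "d = - symb \<theta>"
  have d: "d > 0" and symb: "symb \<theta> = - d"
    using assms(2) symb_nonpos[of \<theta>] by (simp_all add: d_def)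
  have x: "(sin (fst \<theta>))\<^sup>2 \<le> 2 * (1 - cos (fst \<theta>))" "2 * (1 - cos (fst \<theta>)) \<le> d"
    using sin_squared_le[of "fst \<theta>"] cos_le_one[of "snd \<theta>"] by (simp_all add: d_def symb_def)
  have ph: "(sin (phase m \<theta>))\<^sup>2 \<le> 2 * (K m * d)"
    using sin_squared_le[of "phase m \<theta>"] one_minus_cos_phase_le[of m \<theta>]
    by (simp add: K_def d_def)
  have "2 * \<bar>sin (phase m \<theta>) * sin (fst \<theta>)\<bar> \<le> (sin (phase m \<theta>))\<^sup>2 + (sin (fst \<theta>))\<^sup>2"
    using sum_squares_bound[of "\<bar>sin (phase m \<theta>)\<bar>" "\<bar>sin (fst \<theta>)\<bar>"] by (simp add: abs_mult)
  also have "\<dots> \<le> 2 * (K m * d) + d"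
    using ph x by linarith
  also have "\<dots> \<le> 2 * ((K m + 1) * d)"
    using d by (simp add: algebra_simps)
  finally have 1: "\<bar>sin (phase m \<theta>) * sin (fst \<theta>) / symb \<theta>\<bar> \<le> K m + 1"
    using d by (simp add: symb abs_divide pos_divide_le_eq)
  have "\<bar>2 * cos (fst \<theta>) * symb \<theta> + 4 * (sin (fst \<theta>))\<^sup>2\<bar>
      \<le> \<bar>2 * cos (fst \<theta>) * symb \<theta>\<bar> + \<bar>4 * (sin (fst \<theta>))\<^sup>2\<bar>"
    by (rule abs_triangle_ineq)
  also have "\<dots> \<le> 2 * 1 * d + 4 * d"
    using x d by (intro add_mono) (auto simp: symb abs_mult)
  finally have 2: "\<bar>(2 * cos (fst \<theta>) * symb \<theta> + 4 * (sin (fst \<theta>))\<^sup>2) / symb \<theta>\<bar> \<le> 6"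
    using d by (simp add: symb abs_divide pos_divide_le_eq)
  have "\<bar>flux m \<theta>\<bar> \<le> \<bar>2 + 2 * cos (snd \<theta>)\<bar> *
     (\<bar>- 2 * of_int (fst m) * (sin (phase m \<theta>) * sin (fst \<theta>) / symb \<theta>)\<bar>
      + \<bar>ratio m \<theta> * ((2 * cos (fst \<theta>) * symb \<theta> + 4 * (sin (fst \<theta>))\<^sup>2) / symb \<theta>)\<bar>)"
    unfolding flux_def abs_mult[of "2 + 2 * cos (snd \<theta>)"] by (intro mult_left_mono abs_triangle_ineq) auto
  also have "\<dots> = \<bar>2 + 2 * cos (snd \<theta>)\<bar> *
     (2 * \<bar>of_int (fst m)\<bar> * \<bar>sin (phase m \<theta>) * sin (fst \<theta>) / symb \<theta>\<bar>
      + \<bar>ratio m \<theta>\<bar> * \<bar>(2 * cos (fst \<theta>) * symb \<theta> + 4 * (sin (fst \<theta>))\<^sup>2) / symb \<theta>\<bar>)"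
    by (simp add: abs_mult)
  also have "\<dots> \<le> 4 * (2 * \<bar>of_int (fst m)\<bar> * (K m + 1) + K m * 6)"
  proof (intro mult_mono add_mono order_refl 1 2)
    show "\<bar>2 + 2 * cos (snd \<theta>)\<bar> \<le> 4"
      using cos_le_one[of "snd \<theta>"] cos_ge_minus_one[of "snd \<theta>"] by linarith
    show "\<bar>ratio m \<theta>\<bar> \<le> K m"
      unfolding K_def by (rule abs_ratio_le)
  qed (auto simp: K_def)
  finally show ?thesis .
qed

lemma integrable_flux: "integrable torus (flux m)"
  by (rule integrable_torusI[OF flux_measurable abs_flux_le])

text \<open>The antiderivative carries the factor sin x, so it vanishes at both x = pi and x =
  -pi.\<close>

lemma integral_flux: "integral\<^sup>L torus (flux m) = 0"
proof (rule integral_torus_eq_0[OF integrable_flux, where F = "\<lambda>x y.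
      (cos (phase m (x, y)) - 1) * (2 * sin x * (2 + 2 * cos y)) / symb (x, y)"])
  fix y :: real assume y: "y \<in> {-pi..pi}" "y \<noteq> 0"
  \<comment> \<open>Here x runs over the whole line, so (x, y) may leave the square of
    \<open>symb_zero_iff\<close>. The vanishing of sin(y/2) is therefore transferred to (0, y),
    which lies in it.\<close>
  have nz: "symb (x, y) \<noteq> 0" for x
  proof
    assume "symb (x, y) = 0"
    then have "(sin (x / 2))\<^sup>2 + (sin (y / 2))\<^sup>2 = 0"
      by (simp add: symb_eq del: distrib_left_numeral)
    then have "sin (y / 2) = 0"
      by (simp only: sum_power2_eq_zero_iff)
    then have "symb (0, y) = 0" by (simp add: symb_eq)
    with symb_zero_iff[of "(0, y)"] y show False by (simp add: zero_prod_def)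
  qed
  show "((\<lambda>x. (cos (phase m (x, y)) - 1) * (2 * sin x * (2 + 2 * cos y)) / symb (x, y))
      has_real_derivative flux m (x, y)) (at x)" for x
  proof -
    have "((\<lambda>x. phase m (x, y)) has_real_derivative of_int (fst m)) (at x)"
      unfolding phase_def by (auto intro!: derivative_eq_intros)
    moreover have "((\<lambda>x. symb (x, y)) has_real_derivative - (2 * sin x)) (at x)"
      unfolding symb_def by (auto intro!: derivative_eq_intros)
    ultimately show ?thesis
      using nz[of x] unfolding flux_def ratio_def
      by (auto intro!: derivative_eq_intros simp: field_simps power2_eq_square)
  qed
  show "continuous_on UNIV (\<lambda>x. flux m (x, y))"
    using nz unfolding phase_def flux_def ratio_def symb_def
    by (auto intro!: continuous_intros)
qed auto

text \<open>What remains of the defect after removing the flux terms. It accounts for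
  differentiating cos(m.\<theta>) - 1 instead of cos(m.\<theta>), and its integral fixes the
  constant in \<open>L H = G + c\<close>.\<close>

definition const_density :: "real \<times> real \<Rightarrow> real" where
  "const_density \<theta> = 2 * (4 * cos (fst \<theta>) * cos (snd \<theta>) - 4) / symb \<theta>"

lemma const_density_measurable [measurable]: "const_density \<in> borel_measurable borel"
  supply borel_measurable_fst_snd [measurable] unfolding const_density_def by measurable

text \<open>\<open>16 (L H - G)\<close> at a point \<open>m\<close>, up to terms that vanish because \<open>L G\<close> is supported at 0.\<close>

definition defect :: "(lattice \<Rightarrow> real) \<Rightarrow> lattice \<Rightarrow> real" where
  "defect g m =
    (let F = (\<lambda>k. 2 * g k + g (k + e2) + g (k - e2)); K = (\<lambda>k. 2 * g k + g (k + e1) + g (k - e1))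
     in 2 * of_int (fst m) * (F (m + e1) - F (m - e1)) + (F (m + e1) + F (m - e1))
      + 2 * of_int (snd m) * (K (m + e2) - K (m - e2)) + (K (m + e2) + K (m - e2))
      - 2 * L g m - 16 * g m)"

text \<open>The integration by parts, pointwise: x, y and sx, sy are the cosines and sines of the
  two angles, C and S those of the phase, a and b the components of m, s the symbol. The terms with
  a and b agree directly; the rest reduces on both sides to 8 C (x y - 1) / s.\<close>

lemma trig_symbol_identity:
  fixes C S x sx y sy a b :: real
  assumes "s = 2 * x + 2 * y - 4" "s \<noteq> 0" "x\<^sup>2 + sx\<^sup>2 = 1" "y\<^sup>2 + sy\<^sup>2 = 1"
  shows "2 * a * (- 2 * sx * S * (2 + 2 * y) / s) + (2 * x * (2 + 2 * y) * C - 8) / s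
     + 2 * b * (- 2 * sy * S * (2 + 2 * x) / s) + (2 * y * (2 + 2 * x) * C - 8) / s
     - 2 * C - 16 * ((C - 1) / s) =
     2 * ((2 + 2 * y) * (- 2 * a * (S * sx / s) + (C - 1) / s * ((2 * x * s + 4 * sx\<^sup>2) / s)))
     + 2 * ((2 + 2 * x) * (- 2 * b * (S * sy / s) + (C - 1) / s * ((2 * y * s + 4 * sy\<^sup>2) / s)))
     + 2 * (4 * x * y - 4) / s"
proof -
  have sx: "4 * sx\<^sup>2 = (2 - 2 * x) * (2 + 2 * x)" and sy: "4 * sy\<^sup>2 = (2 - 2 * y) * (2 + 2 * y)"
    using assms by (simp_all add: algebra_simps power2_eq_square)
  \<comment> \<open>Only in the sum of the two directions do the numerators combine to a multiple of
    s, which removes one division by s.\<close>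
  have T: "(2 + 2 * y) * ((2 * x * s + 4 * sx\<^sup>2) / s) + (2 + 2 * x) * ((2 * y * s + 4 * sy\<^sup>2) / s)
      = 4 * x * y - 4"
  proof -
    have "(2 + 2 * y) * (2 * x * s + 4 * sx\<^sup>2) + (2 + 2 * x) * (2 * y * s + 4 * sy\<^sup>2)
        = (4 * x * y - 4) * s"
      unfolding sx sy assms(1) by (simp add: algebra_simps)
    then show ?thesis
      using assms(2) by (simp add: add_divide_distrib [symmetric] divide_eq_eq)
  qed
  have "2 * ((2 + 2 * y) * (- 2 * a * (S * sx / s) + (C - 1) / s * ((2 * x * s + 4 * sx\<^sup>2) / s)))
     + 2 * ((2 + 2 * x) * (- 2 * b * (S * sy / s) + (C - 1) / s * ((2 * y * s + 4 * sy\<^sup>2) / s)))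
    = - 4 * a * (2 + 2 * y) * (S * sx / s) - 4 * b * (2 + 2 * x) * (S * sy / s)
    + 2 * ((C - 1) / s) * ((2 + 2 * y) * ((2 * x * s + 4 * sx\<^sup>2) / s) + (2 + 2 * x) * ((2 * y * s + 4 * sy\<^sup>2) / s))"
    by (simp only: distrib_left distrib_right mult_ac add_ac mult_minus_left mult_minus_right)
  also have "\<dots> = - 4 * a * (2 + 2 * y) * (S * sx / s) - 4 * b * (2 + 2 * x) * (S * sy / s)
    + 2 * ((C - 1) / s) * (4 * x * y - 4)"
    unfolding T ..
  finally have eq: "2 * ((2 + 2 * y) * (- 2 * a * (S * sx / s) + (C - 1) / s * ((2 * x * s + 4 * sx\<^sup>2) / s)))
     + 2 * ((2 + 2 * x) * (- 2 * b * (S * sy / s) + (C - 1) / s * ((2 * y * s + 4 * sy\<^sup>2) / s))) = \<dots>" .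
  have "4 * C * x + 4 * C * y - 8 * C = 2 * C * s"
    unfolding assms(1) by (simp add: algebra_simps)
  \<comment> \<open>The one term without denominator is put over s, so that the identity becomes one
    between numerators.\<close>
  then have C: "2 * C = (4 * C * x + 4 * C * y - 8 * C) / s"
    using assms(2) by simp
  show ?thesis
    unfolding eq
    unfolding C add_divide_distrib [symmetric] diff_divide_distrib [symmetric]
      times_divide_eq_right times_divide_eq_left
    by (rule arg_cong[where f = "\<lambda>z. z / s"]) (simp add: algebra_simps)
qed

lemma defect_ratio:
  assumes "symb \<theta> \<noteq> 0"
  shows "defect (\<lambda>k. ratio k \<theta>) m =
    2 * flux m \<theta> + 2 * flux (prod.swap m) (prod.swap \<theta>) + const_density \<theta>"
proof -
  \<comment> \<open>The weighted average turns cos(k.\<theta>) into (2 + 2 cos theta_2)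
    cos(k.\<theta>), and the constant -1 into -4, the total weight being 2 + 1 + 1.\<close>
  have F: "2 * ratio k \<theta> + ratio (k + e2) \<theta> + ratio (k - e2) \<theta> =
      ((2 + 2 * cos (snd \<theta>)) * cos (phase k \<theta>) - 4) / symb \<theta>" for k
    by (simp add: ratio_def phase_add phase_diff phase_e2 cos_add cos_diff
        add_divide_distrib [symmetric] algebra_simps)
  have K: "2 * ratio k \<theta> + ratio (k + e1) \<theta> + ratio (k - e1) \<theta> =
      ((2 + 2 * cos (fst \<theta>)) * cos (phase k \<theta>) - 4) / symb \<theta>" for k
    by (simp add: ratio_def phase_add phase_diff phase_e1 cos_add cos_diff
        add_divide_distrib [symmetric] algebra_simps)
  have diff: "(A * cos (p + q) - 4) / s - (A * cos (p - q) - 4) / s = - 2 * sin q * sin p * A / s"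
    and sum: "(A * cos (p + q) - 4) / s + (A * cos (p - q) - 4) / s = (2 * cos q * A * cos p - 8) / s"
    for A p q s :: real
    by (simp_all add: cos_add cos_diff diff_divide_distrib [symmetric]
        add_divide_distrib [symmetric] algebra_simps)
  show ?thesis
    unfolding defect_def Let_def F K L_ratio[OF assms] phase_add phase_diff phase_e1 phase_e2 diff sum
    unfolding flux_def phase_swap symb_swap const_density_def fst_swap snd_swap
    using trig_symbol_identity[OF symb_def assms, of "sin (fst \<theta>)" "sin (snd \<theta>)" "of_int (fst m)"
        "sin (phase m \<theta>)" "cos (phase m \<theta>)" "of_int (snd m)"]
    by (simp add: ratio_def phase_swap)
qed

lemma defect_G: "4 * pi\<^sup>2 * defect G m = integral\<^sup>L torus const_density"
proof -
  have hbi: "has_bochner_integral torus (\<lambda>\<theta>. defect (\<lambda>k. ratio k \<theta>) m) (defect (\<lambda>k. 4 * pi\<^sup>2 * G k) m)"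
    unfolding defect_def Let_def L_def
    by (intro has_bochner_integral_add has_bochner_integral_diff
        has_bochner_integral_mult_right has_integral_ratio)
  have [simp]: "integrable torus (\<lambda>\<theta>. flux k (prod.swap \<theta>))" for k
  proof (rule integrable_torusI)
    have "prod.swap \<in> borel_measurable (borel :: (real \<times> real) measure)"
      by (intro borel_measurable_continuous_onI continuous_on_swap)
    from measurable_compose[OF this flux_measurable]
    show "(\<lambda>\<theta>. flux k (prod.swap \<theta>)) \<in> borel_measurable borel" .
  qed (rule abs_flux_le, simp)
  have "4 * pi\<^sup>2 * defect G m = defect (\<lambda>k. 4 * pi\<^sup>2 * G k) m"
    by (simp add: defect_def Let_def L_def algebra_simps)
  also have "\<dots> = integral\<^sup>L torus (\<lambda>\<theta>. defect (\<lambda>k. ratio k \<theta>) m)"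
    using hbi by (simp add: has_bochner_integral_iff)
  \<comment> \<open>Subtracting the flux terms leaves the integral unchanged, as they integrate to
    0, but makes the integrand independent of m.\<close>
  also have "\<dots> = integral\<^sup>L torus (\<lambda>\<theta>. defect (\<lambda>k. ratio k \<theta>) m
      - 2 * flux m \<theta> - 2 * flux (prod.swap m) (prod.swap \<theta>))"
    using hbi integrable_flux
    by (simp add: has_bochner_integral_iff integral_flux integral_torus_swap[OF flux_measurable])
  also have "\<dots> = integral\<^sup>L torus const_density"
  proof (rule Bochner_Integration.integral_cong_AE)
    show "(\<lambda>\<theta>. defect (\<lambda>k. ratio k \<theta>) m - 2 * flux m \<theta> - 2 * flux (prod.swap m) (prod.swap \<theta>))
        \<in> borel_measurable torus"
      using hbi integrable_flux
      by (intro borel_measurable_integrable Bochner_Integration.integrable_diff integrable_mult_right)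
        (simp_all add: has_bochner_integral_iff)
    show "AE \<theta> in torus. defect (\<lambda>k. ratio k \<theta>) m - 2 * flux m \<theta>
        - 2 * flux (prod.swap m) (prod.swap \<theta>) = const_density \<theta>"
      using AE_torus by eventually_elim (simp add: defect_ratio)
  qed (intro measurable_torus const_density_measurable)
  finally show ?thesis .
qed

section \<open>The biharmonic equation and the Stokes kernels\<close>

lemma L_H_ex_const: "\<exists>c. \<forall>m. L H m = G m + c"
proof -
  have "16 * L H (a, b) = 16 * G (a, b) + defect G (a, b)" for a b
  proof -
    \<comment> \<open>All three points share the first coordinate a, so \<open>L G\<close> vanishes
      at each unless a = 0, and then the coefficient does.\<close>
    have "(of_int a)\<^sup>2 * (2 * L G (a, b) + L G (a, b + 1) + L G (a, b - 1)) = 0"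
      by (cases "a = 0") (simp_all add: L_G_eq_0 zero_prod_def)
    moreover have "(of_int b)\<^sup>2 * (2 * L G (a, b) + L G (a + 1, b) + L G (a - 1, b)) = 0"
      by (cases "b = 0") (simp_all add: L_G_eq_0 zero_prod_def)
    \<comment> \<open>Discrete product rule: L(m_1^2 F) is m_1^2 L F + 2 m_1 (F(m+e1) - F(m-e1)) +
      F(m+e1) + F(m-e1), and likewise for m_2. The two facts above remove the quadratic terms; the
      others make up \<open>defect\<close>.\<close>
    ultimately show ?thesis
      by (simp add: L_def H_def defect_def Let_def field_simps power2_eq_square)
  qed
  moreover have "defect G m = integral\<^sup>L torus const_density / (4 * pi\<^sup>2)" for m
    using defect_G[of m] by (simp add: field_simps)
  ultimately have "\<forall>m. L H m = G m + integral\<^sup>L torus const_density / (4 * pi\<^sup>2) / 16"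
    by (auto simp: field_simps)
  then show ?thesis by blast
qed

text \<open>These are the coefficients of the two source components in the two momentum equations.
  \<open>L\<close> commutes with differences, and the differences kill the constant in
  \<open>L H = G + c\<close>. The diagonal cases then become \<open>L G k = 0\<close>; in the mixed
  cases the same second difference of \<open>G\<close> appears twice and cancels, a backward
  difference being a shifted forward one.\<close>

lemma kernel_momentum:
  assumes "k \<noteq> 0"
  shows "L (Dyy H) k + Dxp (Dxm G) k = 0"
    and "- L (\<lambda>k. Dyp (Dxp H) (k - e2)) k + Dxp (Dym G) k = 0"
    and "- L (\<lambda>k. Dyp (Dxp H) (k - e1)) k + Dyp (Dxm G) k = 0"
    and "L (Dxx H) k + Dyp (Dym G) k = 0"
proof -
  obtain a b where k: "k = (a, b)" by force
  obtain c where c: "\<And>m. L H m = G m + c"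
    using L_H_ex_const by blast
  have G: "L G k = 0"
    using assms by (rule L_G_eq_0)
  have "L (Dyy H) k = Dyy (L H) k" "L (Dxx H) k = Dxx (L H) k"
    "L (\<lambda>k. Dyp (Dxp H) (k - e2)) k = Dyp (Dxp (L H)) (k - e2)"
    "L (\<lambda>k. Dyp (Dxp H) (k - e1)) k = Dyp (Dxp (L H)) (k - e1)"
    by (simp_all add: k L_def Dyy_def Dxx_def Dxp_def Dyp_def)
  then show "L (Dyy H) k + Dxp (Dxm G) k = 0"
    "- L (\<lambda>k. Dyp (Dxp H) (k - e2)) k + Dxp (Dym G) k = 0"
    "- L (\<lambda>k. Dyp (Dxp H) (k - e1)) k + Dyp (Dxm G) k = 0"
    "L (Dxx H) k + Dyp (Dym G) k = 0"
    using G by (simp_all add: k c [abs_def] L_def Dyy_def Dxx_def Dxp_def Dyp_def Dxm_def Dym_def)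
qed

theorem theorem3p1:
  fixes h \<mu> :: real
    and N :: "(int \<times> int) set"
    and C :: "(real \<times> real) set"
    and qu qv u v p :: "int \<times> int \<Rightarrow> real"
  assumes "h > 0" and "\<mu> > 0"
    and "finite N"
    and "C = (\<Union>n\<in>N. cell n)"
    and "\<And>m. (vector [u m, v m] :: real^2) = (\<Sum>n\<in>N. kernel_S \<mu> (m - n) *v vector [qu n, qv n])"
    and "\<And>m. p m = (\<Sum>n\<in>N. kernel_P h (m - n) \<bullet> vector [qu n, qv n])"
  shows "\<forall>m. (stencil_u m \<inter> C = {} \<longrightarrow> momentum_u h \<mu> u p m) \<and>
             (stencil_v m \<inter> C = {} \<longrightarrow> momentum_v h \<mu> v p m) \<and>
             (stencil_c m \<inter> C = {} \<longrightarrow> continuity u v m)"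
proof -
  have S: "(kernel_S \<mu> k *v vector [a, b]) $ 1 = (Dyp (Dxp H) (k - e2) * b - Dyy H k * a) / \<mu>"
    "(kernel_S \<mu> k *v vector [a, b]) $ 2 = (Dyp (Dxp H) (k - e1) * a - Dxx H k * b) / \<mu>" for k a b
    by (simp_all add: kernel_S_def matrix_vector_mult_def sum_2 diff_divide_distrib)
  \<comment> \<open>Multiplying velocities by \<mu>, and below pressures by h, clears the prefactors
    of the kernels.\<close>
  have u: "\<mu> * u m = (\<Sum>n\<in>N. Dyp (Dxp H) (m - n - e2) * qv n - Dyy H (m - n) * qu n)" for m
    using arg_cong[OF assms(5)[of m], of "\<lambda>w. w $ 1"] assms(2)
    by (simp add: S sum_divide_distrib [symmetric])
  have v: "\<mu> * v m = (\<Sum>n\<in>N. Dyp (Dxp H) (m - n - e1) * qu n - Dxx H (m - n) * qv n)" for m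
    using arg_cong[OF assms(5)[of m], of "\<lambda>w. w $ 2"] assms(2)
    by (simp add: S sum_divide_distrib [symmetric])
  have "p m = (\<Sum>n\<in>N. Dxm G (m - n) * qu n + Dym G (m - n) * qv n) / h" for m
    by (simp add: assms(6) kernel_P_def inner_vec_def sum_2 add_divide_distrib sum_divide_distrib)
  then have p: "h * p m = (\<Sum>n\<in>N. Dxm G (m - n) * qu n + Dym G (m - n) * qv n)" for m
    using assms(1) by simp
  note push_sums = sum_distrib_left sum.distrib [symmetric] sum_subtractf [symmetric]
  \<comment> \<open>The node \<open>p_node m\<close> is the center of \<open>cell m\<close>, so its
    absence from \<open>C\<close> forces m to differ from every source index.\<close>
  have notin: "m - n \<noteq> 0" if "p_node m \<notin> C" "n \<in> N" for m n
    using that by (auto simp: assms(4) cell_def p_node_def)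
  have "momentum_u h \<mu> u p m" if "stencil_u m \<inter> C = {}" for m
  proof -
    have "- \<mu> * L u m + h * (p (m + e1) - p m) = 4 * (\<mu> * u m) - \<mu> * u (m + e1) - \<mu> * u (m - e1)
        - \<mu> * u (m + e2) - \<mu> * u (m - e2) + h * p (m + e1) - h * p m"
      by (simp add: L_def algebra_simps)
    \<comment> \<open>Collecting the coefficients of \<open>qu n\<close> and \<open>qv n\<close>
      reduces the equation to the kernel identities at \<open>m - n\<close>.\<close>
    also have "\<dots> = (\<Sum>n\<in>N.
        (L (Dyy H) (m - n) + Dxp (Dxm G) (m - n)) * qu n
        + (- L (\<lambda>k. Dyp (Dxp H) (k - e2)) (m - n) + Dxp (Dym G) (m - n)) * qv n)"
      unfolding u p push_sums
      by (intro sum.cong refl) (simp add: L_def Dxp_def[of "Dxm G"] Dxp_def[of "Dym G"] algebra_simps)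
    also have "\<dots> = 0"
    proof (intro sum.neutral ballI)
      fix n assume "n \<in> N"
      moreover have "p_node m \<notin> C"
        using that by (auto simp: stencil_u_def)
      ultimately have nz: "m - n \<noteq> 0"
        by (intro notin)
      show "(L (Dyy H) (m - n) + Dxp (Dxm G) (m - n)) * qu n
        + (- L (\<lambda>k. Dyp (Dxp H) (k - e2)) (m - n) + Dxp (Dym G) (m - n)) * qv n = 0"
        by (simp only: kernel_momentum[OF nz] mult_zero_left add_0)
    qed
    finally show ?thesis
      by (simp add: momentum_u_def)
  qed
  moreover have "momentum_v h \<mu> v p m" if "stencil_v m \<inter> C = {}" for m
  proof -
    have "- \<mu> * L v m + h * (p (m + e2) - p m) = 4 * (\<mu> * v m) - \<mu> * v (m + e1) - \<mu> * v (m - e1)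
        - \<mu> * v (m + e2) - \<mu> * v (m - e2) + h * p (m + e2) - h * p m"
      by (simp add: L_def algebra_simps)
    also have "\<dots> = (\<Sum>n\<in>N.
        (- L (\<lambda>k. Dyp (Dxp H) (k - e1)) (m - n) + Dyp (Dxm G) (m - n)) * qu n
        + (L (Dxx H) (m - n) + Dyp (Dym G) (m - n)) * qv n)"
      unfolding v p push_sums
      by (intro sum.cong refl) (simp add: L_def Dyp_def[of "Dxm G"] Dyp_def[of "Dym G"] algebra_simps)
    also have "\<dots> = 0"
    proof (intro sum.neutral ballI)
      fix n assume "n \<in> N"
      moreover have "p_node m \<notin> C"
        using that by (auto simp: stencil_v_def)
      ultimately have nz: "m - n \<noteq> 0"
        by (intro notin)
      show "(- L (\<lambda>k. Dyp (Dxp H) (k - e1)) (m - n) + Dyp (Dxm G) (m - n)) * qu n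
        + (L (Dxx H) (m - n) + Dyp (Dym G) (m - n)) * qv n = 0"
        by (simp only: kernel_momentum[OF nz] mult_zero_left add_0)
    qed
    finally show ?thesis
      by (simp add: momentum_v_def)
  qed
  moreover have "continuity u v m" for m
  proof -
    \<comment> \<open>Each column of \<open>kernel_S\<close> is a discrete curl of a first
      difference of \<open>H\<close>, so its discrete divergence cancels source by source because
      differences commute.\<close>
    have "\<mu> * u m - \<mu> * u (m - e1) + \<mu> * v m - \<mu> * v (m - e2) = 0"
      unfolding u v push_sums
    proof (intro sum.neutral ballI)
      fix n
      obtain a b where k: "m - n = (a, b)" by force
      have "m - e1 - n = (a - 1, b)" "m - e2 - n = (a, b - 1)"
        using k by (auto simp: prod_eq_iff)
      with k show "Dyp (Dxp H) (m - n - e2) * qv n - Dyy H (m - n) * qu n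
          - (Dyp (Dxp H) (m - e1 - n - e2) * qv n - Dyy H (m - e1 - n) * qu n)
          + (Dyp (Dxp H) (m - n - e1) * qu n - Dxx H (m - n) * qv n)
          - (Dyp (Dxp H) (m - e2 - n - e1) * qu n - Dxx H (m - e2 - n) * qv n) = 0"
        by (simp add: Dyp_def Dxp_def Dxx_def Dyy_def) (simp add: algebra_simps)
    qed
    then have "\<mu> * (u m - u (m - e1) + v m - v (m - e2)) = 0"
      by (simp add: algebra_simps)
    then show ?thesis
      using assms(2) by (simp add: continuity_def)
  qed
  ultimately show ?thesis by blast
qed

end
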